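(* Let $a_1,\dots,a_n\in\mathbb{R}$, let $f_k(x)=(x-a_k)^2/2$ for $k\in[n]$, and let $\rho\in(0,1)$. Let $(x_k^t,\mu_k^t)_{k\in[n],\,t\ge0}$ be the iterates of the AsylADMM algorithm (described in the context) with step size $\rho$, and let $x^*=\frac1n\sum_{k=1}^n a_k$ and $\mu_k^*=(x^*-a_k)/d_k$. Then, for all nodes $k\in[n]$, almost surely as $t\to\infty$, $$x_k^t-x^*\to 0,\qquad \mu_k^t-\mu_k^*\to 0.$$
   Context: Graph: $G=([n],E)$ is an undirected, connected, non-bipartite graph with $n\ge2$ nodes; $d_k$ is the degree of node $k$. Each edge $e=(i,j)\in E$ has sampling probability $p_e=\frac1n\left(\frac1{d_i}+\frac1{d_j}\right)>0$ (these sum to $1$). AsylADMM (scalar case): initialize $x_k^0=a_k$, $\mu_k^0=0$ for all $k\in[n]$. At each iteration $t=0,1,2,\dots$, draw (independently across iterations) an edge $e=(i,j)\in E$ with probability $p_e$, set $z_e=\frac12(x_i^t+x_j^t)$, and for $k\in\{i,j\}$ set $$\mu_k^{t+1}=\mu_k^t+\frac{\rho}{d_k}(z_e-x_k^t),\qquad x_k^{t+1}=\operatorname{prox}_{f_k/(\rho d_k)}\!\left(z_e+\mu_k^{t+1}/\rho\right),$$ while $x_k^{t+1}=x_k^t$, $\mu_k^{t+1}=\mu_k^t$ for $k\notin\{i,j\}$. Here $\operatorname{prox}_h(v)=\operatorname{argmin}_{w\in\mathbb{R}}\{h(w)+\frac12(w-v)^2\}$; for $f_k(x)=(x-a_k)^2/2$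 one has $\operatorname{prox}_{f_k/(\rho d_k)}(v)=\frac{\rho d_k v+a_k}{\rho d_k+1}$. *)

theory Defs
  imports "HOL-Probability.Probability"
begin

text \<open>An undirected simple graph on the node set \<open>{1..n}\<close> is given by its set of edges,
  an edge being an unordered pair of two distinct nodes.\<close>

definition simple_graph :: "nat \<Rightarrow> nat set set \<Rightarrow> bool" where
  "simple_graph n E \<longleftrightarrow> (\<forall>e\<in>E. \<exists>i\<in>{1..n}. \<exists>j\<in>{1..n}. i \<noteq> j \<and> e = {i, j})"

definition connected_graph :: "nat \<Rightarrow> nat set set \<Rightarrow> bool" where
  "connected_graph n E \<longleftrightarrow> (\<forall>u\<in>{1..n}. \<forall>v\<in>{1..n}. (u, v) \<in> {(i, j). {i, j} \<in> E}\<^sup>*)"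

definition bipartite_graph :: "nat \<Rightarrow> nat set set \<Rightarrow> bool" where
  "bipartite_graph n E \<longleftrightarrow>
     (\<exists>A B. A \<union> B = {1..n} \<and> A \<inter> B = {} \<and> (\<forall>e\<in>E. \<exists>i\<in>A. \<exists>j\<in>B. e = {i, j}))"

definition node_degree :: "nat set set \<Rightarrow> nat \<Rightarrow> nat" where
  "node_degree E k = card {e \<in> E. k \<in> e}"

text \<open>For an edge \<open>e = {i, j}\<close> with \<open>i \<noteq> j\<close>, the sum over \<open>k \<in> e\<close> below is
  \<open>1 / d\<^sub>i + 1 / d\<^sub>j\<close>; the same convention gives \<open>z\<^sub>e = (x\<^sub>i + x\<^sub>j) / 2\<close> in \<open>asyl_step\<close>.\<close>

definition edge_prob :: "nat \<Rightarrow> nat set set \<Rightarrow> nat set \<Rightarrow> real" where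
  "edge_prob n E e = (1 / real n) * (\<Sum>k\<in>e. 1 / real (node_degree E k))"

definition prox :: "(real \<Rightarrow> real) \<Rightarrow> real \<Rightarrow> real" where
  "prox h v = (ARG_MIN (\<lambda>w. h w + (1 / 2) * (w - v)\<^sup>2) w. True)"

text \<open>A state is the pair \<open>(x, \<mu>)\<close> of the primal and the dual variables, indexed by the nodes.\<close>

type_synonym admm_state = "(nat \<Rightarrow> real) \<times> (nat \<Rightarrow> real)"

definition asyl_step ::
  "nat set set \<Rightarrow> (nat \<Rightarrow> real \<Rightarrow> real) \<Rightarrow> real \<Rightarrow> nat set \<Rightarrow> admm_state \<Rightarrow> admm_state" where
  "asyl_step E f \<rho> e s =
     (let x = fst s; \<mu> = snd s;
          z = (1 / 2) * (\<Sum>k\<in>e. x k);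
          \<mu>' = (\<lambda>k. if k \<in> e then \<mu> k + \<rho> / real (node_degree E k) * (z - x k) else \<mu> k);
          x' = (\<lambda>k. if k \<in> e
                     then prox (\<lambda>w. f k w / (\<rho> * real (node_degree E k))) (z + \<mu>' k / \<rho>)
                     else x k)
      in (x', \<mu>'))"

text \<open>\<open>es t\<close> is the edge drawn at iteration \<open>t\<close>, and \<open>a\<close> is the initial value of the primal
  variables.\<close>

primrec asyl_admm ::
  "nat set set \<Rightarrow> (nat \<Rightarrow> real \<Rightarrow> real) \<Rightarrow> real \<Rightarrow> (nat \<Rightarrow> real) \<Rightarrow> (nat \<Rightarrow> nat set) \<Rightarrow> nat \<Rightarrow> admm_state"
where
  "asyl_admm E f \<rho> a es 0 = (a, \<lambda>k. 0)"
| "asyl_admm E f \<rho> a es (Suc t) = asyl_step E f \<rho> (es t) (asyl_admm E f \<rho> a es t)"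

text \<open>The edges \<open>\<xi> 0, \<xi> 1, \<dots>\<close> are random elements of \<open>E\<close>, independent across iterations,
  and \<open>\<xi> t\<close> equals \<open>e\<close> with probability \<open>edge_prob n E e\<close>.\<close>

definition edge_sampling ::
  "nat \<Rightarrow> nat set set \<Rightarrow> 'w measure \<Rightarrow> (nat \<Rightarrow> 'w \<Rightarrow> nat set) \<Rightarrow> bool" where
  "edge_sampling n E M \<xi> \<longleftrightarrow>
     prob_space.indep_vars M (\<lambda>_. count_space E) \<xi> UNIV \<and>
     (\<forall>t. \<forall>e\<in>E. measure M {\<omega> \<in> space M. \<xi> t \<omega> = e} = edge_prob n E e)"

end

theory Submission
  imports Defs
begin

text \<open>Put \<open>X\<^sub>k = x\<^sub>k - x\<^sup>*\<close>, \<open>m\<^sub>k = d\<^sub>k (\<mu>\<^sub>k - \<mu>\<^sub>k\<^sup>*)\<close> and, using \<open>\<rho> < 1\<close>,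
  \<open>v\<^sub>k = (m\<^sub>k - \<rho> X\<^sub>k) / (1 - \<rho>)\<close>. A step along the edge \<open>{i, j}\<close> replaces \<open>X\<^sub>k\<close> and \<open>v\<^sub>k\<close>, for
  \<open>k \<in> {i, j}\<close>, by convex combinations of \<open>Z = (X\<^sub>i + X\<^sub>j) / 2\<close> and \<open>v\<^sub>k\<close>, and it preserves
  \<open>\<Sum>\<^sub>k m\<^sub>k = 0\<close>. Hence \<open>V = \<Sum>\<^sub>k \<rho> X\<^sub>k\<^sup>2 + (1 - \<rho>) v\<^sub>k\<^sup>2\<close> never increases, and the decrease along
  \<open>{i, j}\<close> controls \<open>(X\<^sub>i - X\<^sub>j)\<^sup>2\<close> and \<open>(v\<^sub>k - Z)\<^sup>2\<close>. Each edge is drawn with a fixed positive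
  probability independently of the past, so the potential decreases along any given edge have
  summable expectations, and therefore tend to \<open>0\<close> almost surely. By connectedness all \<open>X\<^sub>k\<close> and
  \<open>m\<^sub>k\<close> then become equal asymptotically, and \<open>\<Sum>\<^sub>k m\<^sub>k = 0\<close> forces the common value to \<open>0\<close>.\<close>

section \<open>Random iterations with a Lyapunov function\<close>

text \<open>Used to read the state at time \<open>t\<close> off the draws before \<open>t\<close>,
  which makes it independent of the draw at \<open>t\<close>.\<close>

lemma random_iteration_cong:
  assumes "\<And>es. A es 0 = init" and "\<And>es t. A es (Suc t) = F (es t) (A es t)"
    and "\<And>s. s < t \<Longrightarrow> es s = es' s"
  shows "A es t = A es' t"
  using assms(3) by (induction t) (auto simp: assms(1,2))

text \<open>The state space carries the discrete sigma-algebra, so that \<open>F\<close> and later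
  \<open>V\<close> need no measurability assumption; countability of \<open>E\<close> is what allows
  this.\<close>

lemma random_iteration_measurable:
  fixes A :: "(nat \<Rightarrow> 'e) \<Rightarrow> nat \<Rightarrow> 's"
  assumes "\<And>es. A es 0 = init" and "\<And>es t. A es (Suc t) = F (es t) (A es t)"
    and "countable E" and "t \<le> T"
  shows "(\<lambda>es. A es t) \<in> measurable (PiM {..<T} (\<lambda>_. count_space E)) (count_space UNIV)"
  using assms(4)
proof (induction t)
  case 0
  then show ?case by (simp add: assms(1))
next
  case (Suc t)
  have 1: "(\<lambda>es. es t) \<in> measurable (PiM {..<T} (\<lambda>_. count_space E)) (count_space E)"
    using Suc.prems by (intro measurable_component_singleton) auto
  have 2: "(\<lambda>es. F e (A es t)) \<in> measurable (PiM {..<T} (\<lambda>_. count_space E)) (count_space UNIV)" for e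
    by (rule measurable_compose[OF Suc.IH]) (use Suc.prems in auto)
  show ?case
    unfolding assms(2)
    by (rule measurable_compose_countable'[where f = "\<lambda>e es. F e (A es t)", OF 2 1 assms(3)])
qed

text \<open>By monotone convergence the series of the \<open>D t\<close> has finite expectation, so
  it converges almost surely.\<close>

lemma (in prob_space) AE_tendsto_0_if_summable_expectation:
  fixes D :: "nat \<Rightarrow> 'a \<Rightarrow> real"
  assumes "\<And>t. integrable M (D t)" and "\<And>t \<omega>. \<omega> \<in> space M \<Longrightarrow> 0 \<le> D t \<omega>"
    and "summable (\<lambda>t. expectation (D t))"
  shows "AE \<omega> in M. (\<lambda>t. D t \<omega>) \<longlonglongrightarrow> 0"
proof -
  have [measurable]: "D t \<in> borel_measurable M" for t
    using assms(1) by auto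
  have E: "(\<integral>\<^sup>+\<omega>. ennreal (D t \<omega>) \<partial>M) = ennreal (expectation (D t))" for t
    using assms(1,2) by (intro nn_integral_eq_integral) auto
  have "(\<integral>\<^sup>+\<omega>. (\<Sum>t. ennreal (D t \<omega>)) \<partial>M) = (\<Sum>t. ennreal (expectation (D t)))"
    by (subst nn_integral_suminf) (auto simp: E)
  also have "\<dots> = ennreal (\<Sum>t. expectation (D t))"
    using assms(2,3) by (intro suminf_ennreal2) auto
  finally have "(\<integral>\<^sup>+\<omega>. (\<Sum>t. ennreal (D t \<omega>)) \<partial>M) \<noteq> \<infinity>"
    by simp
  then have "AE \<omega> in M. (\<Sum>t. ennreal (D t \<omega>)) \<noteq> \<infinity>"
    by (intro nn_integral_PInf_AE) auto
  then show ?thesis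
  proof (rule AE_mp, intro AE_I2 impI)
    fix \<omega> assume \<omega>: "\<omega> \<in> space M" "(\<Sum>t. ennreal (D t \<omega>)) \<noteq> \<infinity>"
    then have "summable (\<lambda>t. D t \<omega>)"
      using assms(2) by (intro summable_suminf_not_top) auto
    then show "(\<lambda>t. D t \<omega>) \<longlonglongrightarrow> 0"
      by (rule summable_LIMSEQ_zero)
  qed
qed

text \<open>The decrease that drawing \<open>e\<close> would cause at time \<open>t\<close> depends
  on earlier draws only. Its expectation times \<open>p\<close> is therefore the expected decrease
  on the event that \<open>e\<close> is drawn, and these sum to at most \<open>V init\<close> by
  telescoping.\<close>

lemma (in prob_space) AE_lyapunov_decrease_tendsto_0:
  fixes A :: "(nat \<Rightarrow> 'e) \<Rightarrow> nat \<Rightarrow> 's" and V :: "'s \<Rightarrow> real"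
  assumes A0: "\<And>es. A es 0 = init" and AS: "\<And>es t. A es (Suc t) = F (es t) (A es t)"
    and E: "countable E" and indep: "indep_vars (\<lambda>_. count_space E) \<xi> UNIV"
    and V0: "\<And>s. 0 \<le> V s" and Vdec: "\<And>e s. e \<in> E \<Longrightarrow> V (F e s) \<le> V s"
    and e: "e \<in> E" and p: "p > 0" "\<And>t. prob {\<omega> \<in> space M. \<xi> t \<omega> = e} = p"
  shows "AE \<omega> in M. (\<lambda>t. V (A (\<lambda>s. \<xi> s \<omega>) t) - V (F e (A (\<lambda>s. \<xi> s \<omega>) t))) \<longlonglongrightarrow> 0"
proof -
  define S where "S t \<omega> = A (\<lambda>s. \<xi> s \<omega>) t" for t \<omega>
  define D where "D t \<omega> = V (S t \<omega>) - V (F e (S t \<omega>))" for t \<omega>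
  define I where "I t \<omega> = (if \<xi> t \<omega> = e then 1 else 0 :: real)" for t \<omega>
  let ?N = "count_space E :: 'e measure"
  have \<xi>[measurable]: "\<xi> t \<in> measurable M ?N" for t
    using indep by (auto simp: indep_vars_def)
  have \<xi>E: "\<xi> t \<omega> \<in> E" if "\<omega> \<in> space M" for t \<omega>
    using measurable_space[OF \<xi> that] by simp
  have Smono: "V (S (Suc t) \<omega>) \<le> V (S t \<omega>)" if "\<omega> \<in> space M" for t \<omega>
    using Vdec[OF \<xi>E[OF that]] by (simp add: S_def AS)
  have Sbd: "V (S t \<omega>) \<le> V init" if "\<omega> \<in> space M" for t \<omega>
    by (induction t) (use Smono[OF that] in \<open>auto simp: S_def A0 intro: order_trans\<close>)
  have D0: "0 \<le> D t \<omega>" for t \<omega>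
    using Vdec[OF e] by (simp add: D_def)
  have Dbd: "D t \<omega> \<le> V init" if "\<omega> \<in> space M" for t \<omega>
    using Sbd[OF that, of t] V0[of "F e (S t \<omega>)"] by (simp add: D_def)
  \<comment> \<open>\<open>g t\<close> and \<open>h t\<close> express \<open>D t\<close> and
    \<open>I t\<close> through disjoint blocks of draws; this gives their independence.\<close>
  define g where "g t es = V (A es t) - V (F e (A es t))" for t es
  define h where "h t es = (if es t = e then 1 else 0 :: real)" for t and es :: "nat \<Rightarrow> 'e"
  have g: "g t \<in> borel_measurable (PiM {..<t} (\<lambda>_. ?N))" for t
    unfolding g_def
    by (rule measurable_compose[OF random_iteration_measurable[OF A0 AS E order_refl]]) auto
  have h: "h t \<in> borel_measurable (PiM {t} (\<lambda>_. ?N))" for t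
  proof -
    have "(\<lambda>es. es t) \<in> measurable (PiM {t} (\<lambda>_. ?N)) ?N"
      by (intro measurable_component_singleton) auto
    then show ?thesis
      unfolding h_def by (rule measurable_compose[where g = "\<lambda>y. if y = e then 1 else 0"]) auto
  qed
  have gD: "g t (restrict (\<lambda>s. \<xi> s \<omega>) {..<t}) = D t \<omega>" for t \<omega>
    using random_iteration_cong[where A = A and init = init and F = F, OF A0 AS,
        of t "restrict (\<lambda>s. \<xi> s \<omega>) {..<t}" "\<lambda>s. \<xi> s \<omega>"]
    by (simp add: g_def D_def S_def)
  have hI: "h t (restrict (\<lambda>s. \<xi> s \<omega>) {t}) = I t \<omega>" for t \<omega>
    by (simp add: h_def I_def)
  have ind: "indep_var borel (D t) borel (I t)" for t
  proof -
    have "indep_var (PiM {..<t} (\<lambda>_. ?N)) (\<lambda>\<omega>. restrict (\<lambda>s. \<xi> s \<omega>) {..<t})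
        (PiM {t} (\<lambda>_. ?N)) (\<lambda>\<omega>. restrict (\<lambda>s. \<xi> s \<omega>) {t})"
      by (rule indep_var_restrict[OF indep]) auto
    from indep_var_compose[OF this g h] show ?thesis
      by (simp add: comp_def gD hI)
  qed
  have [measurable]: "D t \<in> borel_measurable M" "I t \<in> borel_measurable M" for t
    using ind[of t] by (auto dest: indep_var_rv1 indep_var_rv2)
  have intD: "integrable M (D t)" for t
    by (rule integrable_const_bound[where B = "V init"]) (use D0 Dbd in auto)
  have intI: "integrable M (I t)" for t
    by (rule integrable_const_bound[where B = 1]) (auto simp: I_def)
  have EI: "expectation (I t) = p" for t
  proof -
    have "expectation (I t) = expectation (indicator {\<omega> \<in> space M. \<xi> t \<omega> = e})"
      by (rule Bochner_Integration.integral_cong) (auto simp: I_def indicator_def)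
    then show ?thesis
      by (simp add: p(2))
  qed
  have int: "integrable M (\<lambda>\<omega>. D t \<omega> * I t \<omega>)" for t
    using indep_var_integrable[OF ind intD intI] .
  have Eprod: "expectation (\<lambda>\<omega>. D t \<omega> * I t \<omega>) = expectation (D t) * p" for t
    using indep_var_lebesgue_integral[OF ind intD intI] by (simp add: EI)
  have path: "(\<Sum>t<T. D t \<omega> * I t \<omega>) \<le> V init" if "\<omega> \<in> space M" for T \<omega>
  proof -
    \<comment> \<open>If \<open>e\<close> is drawn, the term is the actual decrease of
      \<open>V\<close>; otherwise it is \<open>0\<close>, and the actual decrease is
      nonnegative.\<close>
    have "(\<Sum>t<T. D t \<omega> * I t \<omega>) \<le> (\<Sum>t<T. V (S t \<omega>) - V (S (Suc t) \<omega>))"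
      using Smono[OF that] by (intro sum_mono) (auto simp: I_def D_def S_def AS)
    also have "\<dots> = V (S 0 \<omega>) - V (S T \<omega>)"
      by (rule sum_lessThan_telescope')
    finally show ?thesis
      using V0[of "S T \<omega>"] by (simp add: S_def A0)
  qed
  have bound: "(\<Sum>t<T. expectation (D t)) \<le> V init / p" for T
  proof -
    have "(\<Sum>t<T. expectation (D t)) * p = expectation (\<lambda>\<omega>. \<Sum>t<T. D t \<omega> * I t \<omega>)"
      using int by (simp add: Eprod sum_distrib_right)
    also have "\<dots> \<le> expectation (\<lambda>_. V init)"
      by (intro integral_mono) (use int path in auto)
    finally show ?thesis
      using p(1) by (simp add: prob_space field_simps)
  qed
  have "summable (\<lambda>t. expectation (D t))"
    by (rule bounded_imp_summable[where B = "V init / p"])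
      (use D0 bound[of "Suc _"] in \<open>auto simp: lessThan_Suc_atMost intro: integral_nonneg\<close>)
  from AE_tendsto_0_if_summable_expectation[OF intD D0 this] show ?thesis
    by (simp add: D_def S_def)
qed

lemma tendsto_0_if_scaled_square_le:
  fixes g u :: "nat \<Rightarrow> real"
  assumes "u \<longlonglongrightarrow> 0" and "c > 0" and "\<And>t. c * (g t)\<^sup>2 \<le> u t"
  shows "g \<longlonglongrightarrow> 0"
proof -
  have "(\<lambda>t. (g t)\<^sup>2) \<longlonglongrightarrow> 0"
  proof (rule tendsto_sandwich[OF _ _ tendsto_const])
    show "(\<lambda>t. u t / c) \<longlonglongrightarrow> 0"
      using tendsto_divide[OF assms(1) tendsto_const[of c]] assms(2) by simp
  qed (use assms(2,3) in \<open>auto simp: field_simps\<close>)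
  then show ?thesis
    by (simp add: power_tendsto_0_iff)
qed

section \<open>Quadratic objectives\<close>

lemma prox_quadratic:
  fixes c a v :: real
  assumes "c > 0"
  shows "prox (\<lambda>w. (w - a)\<^sup>2 / 2 / c) v = (c * v + a) / (c + 1)"
proof -
  define q where "q w = (w - a)\<^sup>2 / 2 / c + (1 / 2) * (w - v)\<^sup>2" for w
  define w0 where "w0 = (c * v + a) / (c + 1)"
  have w0: "(c + 1) * w0 = c * v + a"
    using assms by (simp add: w0_def)
  \<comment> \<open>Completing the square at the stationary point \<open>w0\<close>. This makes
    \<open>w0\<close> the unique minimizer, so \<open>arg_min\<close> must return it.\<close>
  have q: "q w = q w0 + (c + 1) / (2 * c) * (w - w0)\<^sup>2" for w
  proof -
    have a: "a = (c + 1) * w0 - c * v"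
      using w0 by simp
    show ?thesis
      using assms unfolding q_def a by (simp add: field_simps power2_eq_square)
  qed
  have less: "q w0 < q w" if "w \<noteq> w0" for w
    using that assms unfolding q[of w] by simp
  have "arg_min q (\<lambda>_. True) = w0"
    unfolding arg_min_def is_arg_min_def
    by (rule some_equality) (use less in \<open>force intro: less_imp_le\<close>)+
  then show ?thesis
    by (simp add: prox_def q_def[abs_def] w0_def)
qed

section \<open>Shifted coordinates and the potential\<close>

locale quadratic_admm =
  fixes n :: nat and E :: "nat set set" and a :: "nat \<Rightarrow> real" and f :: "nat \<Rightarrow> real \<Rightarrow> real"
    and \<rho> :: real
  assumes n: "n \<ge> 2" and simple: "simple_graph n E" and connected: "connected_graph n E"
    and f: "\<And>k y. k \<in> {1..n} \<Longrightarrow> f k y = (y - a k)\<^sup>2 / 2"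
    and \<rho>: "0 < \<rho>" "\<rho> < 1"
begin

definition avg :: real where
  "avg = (1 / real n) * (\<Sum>k=1..n. a k)"

definition deg :: "nat \<Rightarrow> real" where
  "deg k = real (node_degree E k)"

definition X :: "admm_state \<Rightarrow> nat \<Rightarrow> real" where
  "X s k = fst s k - avg"

text \<open>The factor \<open>deg k\<close> clears the degree from the dual update, so that the sum
  of \<open>m\<close> over the nodes is invariant under steps.\<close>

definition m :: "admm_state \<Rightarrow> nat \<Rightarrow> real" where
  "m s k = deg k * snd s k - (avg - a k)"

definition v :: "admm_state \<Rightarrow> nat \<Rightarrow> real" where
  "v s k = (m s k - \<rho> * X s k) / (1 - \<rho>)"

definition V :: "admm_state \<Rightarrow> real" where
  "V s = (\<Sum>k=1..n. \<rho> * (X s k)\<^sup>2 + (1 - \<rho>) * (v s k)\<^sup>2)"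

lemma edgeE:
  assumes "e \<in> E"
  obtains i j where "i \<in> {1..n}" "j \<in> {1..n}" "i \<noteq> j" "e = {i, j}"
  using assms simple by (auto simp: simple_graph_def)

lemma finite_E: "finite E"
proof (rule finite_subset)
  show "E \<subseteq> Pow {1..n}"
    by (auto elim!: edgeE)
qed auto

lemma deg_pos:
  assumes "e \<in> E" "k \<in> e"
  shows "deg k > 0"
  using assms finite_E by (auto simp: deg_def node_degree_def card_gt_0_iff)

lemma edge_prob_pos:
  assumes "e \<in> E"
  shows "edge_prob n E e > 0"
proof -
  have "(\<Sum>k\<in>e. 1 / deg k) > 0"
    using assms deg_pos[OF assms] by (intro sum_pos) (auto elim!: edgeE)
  then show ?thesis
    using n by (simp add: edge_prob_def deg_def)
qed

lemma m_eq: "m s k = (1 - \<rho>) * v s k + \<rho> * X s k"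
  using \<rho> by (simp add: v_def)

section \<open>Effect of one step along a fixed edge\<close>

context
  fixes i j :: nat and s :: admm_state
  assumes ij: "{i, j} \<in> E" "i \<noteq> j"
begin

abbreviation "s' \<equiv> asyl_step E f \<rho> {i, j} s"
abbreviation "Z \<equiv> (X s i + X s j) / 2"

lemma edge_nodes: "i \<in> {1..n}" "j \<in> {1..n}"
  using ij by (auto elim!: edgeE simp: doubleton_eq_iff)

lemma step_m:
  assumes "k \<in> {i, j}"
  shows "m s' k = m s k + \<rho> * (Z - X s k)"
proof -
  have "deg k > 0"
    using deg_pos ij assms by blast
  then show ?thesis
    using assms ij by (auto simp: m_def X_def asyl_step_def Let_def deg_def field_simps)
qed

lemma step_X':
  assumes "k \<in> {i, j}"
  shows "X s' k = (\<rho> * deg k * Z + m s' k) / (\<rho> * deg k + 1)"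
proof -
  have d: "deg k > 0"
    using deg_pos ij assms by blast
  have k: "k \<in> {1..n}"
    using assms edge_nodes by auto
  let ?z = "(fst s i + fst s j) / 2"
  have "fst s' k = prox (\<lambda>w. (w - a k)\<^sup>2 / 2 / (\<rho> * deg k)) (?z + snd s' k / \<rho>)"
    using assms ij by (auto simp: asyl_step_def Let_def deg_def f[OF k])
  also have "\<dots> = (\<rho> * deg k * (?z + snd s' k / \<rho>) + a k) / (\<rho> * deg k + 1)"
    using d \<rho> by (intro prox_quadratic) auto
  \<comment> \<open>By the definition of \<open>m\<close>, \<open>deg k * snd s' k + a k\<close> is
    \<open>m s' k + avg\<close>; the shift by \<open>avg\<close> then passes through the weighted
    average.\<close>
  also have "\<rho> * deg k * (?z + snd s' k / \<rho>) + a k = \<rho> * deg k * ?z + (m s' k + avg)"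
    using \<rho> by (simp add: m_def field_simps)
  finally have "fst s' k = (\<rho> * deg k * ?z + (m s' k + avg)) / (\<rho> * deg k + 1)" .
  moreover have c: "\<rho> * deg k + 1 \<noteq> 0"
    using d \<rho> by (smt (verit) mult_pos_pos)
  ultimately have "fst s' k * (\<rho> * deg k + 1) = \<rho> * deg k * ?z + (m s' k + avg)"
    by (simp only: eq_divide_eq) simp
  then have "X s' k * (\<rho> * deg k + 1) = \<rho> * deg k * Z + m s' k"
    by (simp add: X_def field_simps)
  then show ?thesis
    using c by (simp add: eq_divide_eq)
qed

text \<open>The dual update turns \<open>m = (1 - \<rho>) * v + \<rho> * X\<close> into
  \<open>(1 - \<rho>) * v + \<rho> * Z\<close>, so the old \<open>X s k\<close> survives only
  through \<open>Z\<close>. This is what singles out \<open>v\<close> as the second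
  coordinate.\<close>

lemma step_X:
  assumes "k \<in> {i, j}"
  shows "X s' k = Z + (1 - \<rho>) / (\<rho> * deg k + 1) * (v s k - Z)"
proof -
  define z where "z = Z"
  define c where "c = \<rho> * deg k + 1"
  have c: "c > 0"
    using deg_pos[OF ij(1) assms] \<rho> unfolding c_def by (smt (verit) mult_pos_pos)
  have "m s' k = (1 - \<rho>) * v s k + \<rho> * z"
    unfolding step_m[OF assms] m_eq[of s k] z_def by (simp add: algebra_simps)
  then have "X s' k = (c * z + (1 - \<rho>) * (v s k - z)) / c"
    unfolding step_X'[OF assms] c_def z_def[symmetric] by (simp add: algebra_simps)
  then show ?thesis
    using c by (simp add: add_divide_distrib z_def c_def)
qed

lemma step_v:
  assumes "k \<in> {i, j}"
  shows "v s' k = v s k - \<rho> / (\<rho> * deg k + 1) * (v s k - Z)"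
proof -
  have "m s' k = (1 - \<rho>) * v s k + \<rho> * Z"
    unfolding step_m[OF assms] m_eq[of s k] by (simp add: algebra_simps)
  then have "(1 - \<rho>) * v s' k = (1 - \<rho>) * v s k + \<rho> * Z - \<rho> * X s' k"
    using m_eq[of s' k] by simp
  also have "\<dots> = (1 - \<rho>) * (v s k - \<rho> / (\<rho> * deg k + 1) * (v s k - Z))"
  proof -
    define z where "z = Z"
    show ?thesis
      unfolding step_X[OF assms] z_def[symmetric] by (simp add: algebra_simps)
  qed
  finally show ?thesis
    using \<rho> by simp
qed

lemma step_other:
  assumes "k \<notin> {i, j}"
  shows "X s' k = X s k" "m s' k = m s k" "v s' k = v s k"
  using assms by (auto simp: X_def m_def v_def asyl_step_def Let_def)

text \<open>The two increments cancel because \<open>Z\<close> is the midpoint of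
  \<open>X s i\<close> and \<open>X s j\<close>.\<close>

lemma step_sum_m: "(\<Sum>k=1..n. m s' k) = (\<Sum>k=1..n. m s k)"
proof -
  have "(\<Sum>k=1..n. m s' k - m s k) = (\<Sum>k\<in>{i, j}. m s' k - m s k)"
    using edge_nodes by (intro sum.mono_neutral_right) (auto simp: step_other)
  also have "\<dots> = 0"
    using ij by (simp add: step_m field_simps)
  finally show ?thesis
    by (simp add: sum_subtractf)
qed

definition gain :: "nat \<Rightarrow> real" where
  "gain k = \<rho> * (1 - \<rho>) / (\<rho> * deg k + 1) * (2 - 1 / (\<rho> * deg k + 1))"

lemma gain_pos:
  assumes "k \<in> {i, j}"
  shows "gain k > 0"
proof -
  have "\<rho> * deg k > 0"
    using deg_pos[OF ij(1) assms] \<rho> by simp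
  then have "1 / (\<rho> * deg k + 1) < 2" "\<rho> * deg k + 1 > 0"
    by (auto simp: field_simps)
  then show ?thesis
    using \<rho> by (simp add: gain_def)
qed

text \<open>With \<open>r = 1 / (\<rho> * deg k + 1)\<close>, the weights \<open>\<rho>\<close> and
  \<open>1 - \<rho>\<close> make the cross terms combine to
  \<open>- 2 * \<rho> * (1 - \<rho>) * r * (v s k - Z)\<^sup>2\<close>, while the quadratic terms
  add \<open>\<rho> * (1 - \<rho>) * r\<^sup>2 * (v s k - Z)\<^sup>2\<close>; together they give
  \<open>gain k\<close>.\<close>

lemma step_node:
  assumes "k \<in> {i, j}"
  shows "\<rho> * (X s' k)\<^sup>2 + (1 - \<rho>) * (v s' k)\<^sup>2
    = \<rho> * Z\<^sup>2 + (1 - \<rho>) * (v s k)\<^sup>2 - gain k * (v s k - Z)\<^sup>2"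
proof -
  define r where "r = 1 / (\<rho> * deg k + 1)"
  define z where "z = Z"
  have "\<rho> * (z + (1 - \<rho>) * r * (v s k - z))\<^sup>2 + (1 - \<rho>) * (v s k - \<rho> * r * (v s k - z))\<^sup>2
    = \<rho> * z\<^sup>2 + (1 - \<rho>) * (v s k)\<^sup>2 - \<rho> * (1 - \<rho>) * r * (2 - r) * (v s k - z)\<^sup>2"
    by (simp add: power2_eq_square algebra_simps)
  then show ?thesis
    by (simp add: step_X[OF assms] step_v[OF assms] gain_def r_def z_def)
qed

lemma step_V:
  "V s - V s' = \<rho> / 2 * (X s i - X s j)\<^sup>2 + gain i * (v s i - Z)\<^sup>2 + gain j * (v s j - Z)\<^sup>2"
proof -
  let ?q = "\<lambda>s k. \<rho> * (X s k)\<^sup>2 + (1 - \<rho>) * (v s k)\<^sup>2"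
  have "V s - V s' = (\<Sum>k=1..n. ?q s k - ?q s' k)"
    by (simp add: V_def sum_subtractf)
  also have "\<dots> = (\<Sum>k\<in>{i, j}. ?q s k - ?q s' k)"
    using edge_nodes by (intro sum.mono_neutral_right) (auto simp: step_other)
  also have "\<dots> = \<rho> * ((X s i)\<^sup>2 + (X s j)\<^sup>2 - 2 * Z\<^sup>2) + gain i * (v s i - Z)\<^sup>2 + gain j * (v s j - Z)\<^sup>2"
    using ij(2) step_node[of i] step_node[of j] by (simp add: algebra_simps)
  also have "(X s i)\<^sup>2 + (X s j)\<^sup>2 - 2 * Z\<^sup>2 = (X s i - X s j)\<^sup>2 / 2"
    by (simp add: power2_eq_square field_simps)
  finally show ?thesis
    by simp
qed

lemma step_V_ge:
  shows "\<rho> / 2 * (X s i - X s j)\<^sup>2 \<le> V s - V s'" "gain i * (v s i - Z)\<^sup>2 \<le> V s - V s'"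
    "0 \<le> V s - V s'"
  using gain_pos[of i] gain_pos[of j] \<rho> by (auto simp: step_V)

end

section \<open>Invariants of a run and asymptotic consensus\<close>

lemma V_nonneg: "0 \<le> V s"
  using \<rho> by (auto simp: V_def intro!: sum_nonneg)

lemma V_step_le:
  assumes "e \<in> E"
  shows "V (asyl_step E f \<rho> e s) \<le> V s"
  using assms step_V_ge(3) by (metis diff_ge_0_iff_ge edgeE)

text \<open>Initially the dual variables vanish and the deviations \<open>avg - a k\<close> sum to
  zero; every step preserves the sum.\<close>

lemma sum_m_admm:
  assumes "\<And>t. es t \<in> E"
  shows "(\<Sum>k=1..n. m (asyl_admm E f \<rho> a es t) k) = 0"
proof (induction t)
  case 0
  then show ?case
    using n by (simp add: m_def sum_subtractf avg_def)
next
  case (Suc t)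
  then show ?case
    using assms[of t] step_sum_m by (metis asyl_admm.simps(2) edgeE)
qed

text \<open>The deterministic half of the argument, to be applied to each sample path outside a null
  set.\<close>

lemma consensus:
  assumes dec: "\<And>e. e \<in> E \<Longrightarrow> (\<lambda>t. V (S t) - V (asyl_step E f \<rho> e (S t))) \<longlonglongrightarrow> 0"
    and sum0: "\<And>t. (\<Sum>k=1..n. m (S t) k) = 0" and k: "k \<in> {1..n}"
  shows "(\<lambda>t. X (S t) k) \<longlonglongrightarrow> 0" "(\<lambda>t. m (S t) k) \<longlonglongrightarrow> 0" "deg k > 0"
proof -
  have edge: "(\<lambda>t. X (S t) i - X (S t) j) \<longlonglongrightarrow> 0" "(\<lambda>t. m (S t) i - X (S t) i) \<longlonglongrightarrow> 0"
    if ij: "{i, j} \<in> E" for i j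
  proof -
    have ne: "i \<noteq> j"
      using ij by (auto elim!: edgeE simp: doubleton_eq_iff)
    show 1: "(\<lambda>t. X (S t) i - X (S t) j) \<longlonglongrightarrow> 0"
      by (rule tendsto_0_if_scaled_square_le[OF dec[OF ij], of "\<rho> / 2"])
        (use \<rho> step_V_ge(1)[OF ij ne] in auto)
    have 2: "(\<lambda>t. v (S t) i - (X (S t) i + X (S t) j) / 2) \<longlonglongrightarrow> 0"
      by (rule tendsto_0_if_scaled_square_le[OF dec[OF ij] gain_pos[OF ij ne, of i]])
        (use step_V_ge(2)[OF ij ne] in auto)
    \<comment> \<open>The difference in the bracket is \<open>v - X\<close> at node
      \<open>i\<close>, and \<open>m - X = (1 - \<rho>) * (v - X)\<close>.\<close>
    have "(\<lambda>t. (1 - \<rho>) * ((v (S t) i - (X (S t) i + X (S t) j) / 2) - (X (S t) i - X (S t) j) / 2))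
        \<longlonglongrightarrow> (1 - \<rho>) * (0 - 0 / 2)"
      by (intro tendsto_intros 1 2) auto
    moreover have "(\<lambda>t. (1 - \<rho>) * ((v (S t) i - (X (S t) i + X (S t) j) / 2) - (X (S t) i - X (S t) j) / 2))
        = (\<lambda>t. m (S t) i - X (S t) i)"
      by (auto simp: m_eq field_simps)
    ultimately show "(\<lambda>t. m (S t) i - X (S t) i) \<longlonglongrightarrow> 0"
      by simp
  qed
  have path: "(\<lambda>t. X (S t) u - X (S t) w) \<longlonglongrightarrow> 0" if "u \<in> {1..n}" "w \<in> {1..n}" for u w
  proof -
    have "(u, w) \<in> {(i, j). {i, j} \<in> E}\<^sup>*"
      using connected that by (auto simp: connected_graph_def)
    then show ?thesis
    proof induction
      case (step y z)
      then have "(\<lambda>t. (X (S t) u - X (S t) y) + (X (S t) y - X (S t) z)) \<longlonglongrightarrow> 0 + 0"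
        by (intro tendsto_add) (auto intro: edge)
      then show ?case
        by simp
    qed auto
  qed
  have nbr: "\<exists>w. {u, w} \<in> E" if "u \<in> {1..n}" for u
  proof -
    \<comment> \<open>Since \<open>n\<close> is at least 2 there is a second node, and the first
      edge of a path to it is incident to \<open>u\<close>.\<close>
    obtain w where w: "w \<in> {1..n}" "w \<noteq> u"
      using n that[of "if u = 1 then 2 else 1"] by (auto split: if_splits)
    then have "(u, w) \<in> {(i, j). {i, j} \<in> E}\<^sup>*"
      using connected that by (auto simp: connected_graph_def)
    then show ?thesis
      using w(2) by (auto elim: converse_rtranclE)
  qed
  have mX: "(\<lambda>t. m (S t) u - X (S t) u) \<longlonglongrightarrow> 0" if "u \<in> {1..n}" for u
    using nbr[OF that] edge(2) by blast
  \<comment> \<open>Each summand equals \<open>X (S t) k - m (S t) u\<close>; as the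
    \<open>m (S t) u\<close> sum to zero, the mean is exactly \<open>X (S t) k\<close>.\<close>
  have "(\<lambda>t. (1 / real n) * (\<Sum>u=1..n. (X (S t) k - X (S t) u) - (m (S t) u - X (S t) u)))
      \<longlonglongrightarrow> (1 / real n) * (\<Sum>u=1..n. 0 - 0)"
    by (intro tendsto_intros path mX k)
  moreover have "(1 / real n) * (\<Sum>u=1..n. (X (S t) k - X (S t) u) - (m (S t) u - X (S t) u))
      = X (S t) k" for t
    using n sum0[of t] by (simp add: sum_subtractf)
  ultimately show X0: "(\<lambda>t. X (S t) k) \<longlonglongrightarrow> 0"
    by simp
  show "(\<lambda>t. m (S t) k) \<longlonglongrightarrow> 0"
    using tendsto_add[OF mX[OF k] X0] by simp
  show "deg k > 0"
    using nbr[OF k] deg_pos by blast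
qed

end

section \<open>Almost sure convergence of the iterates\<close>

theorem theorem3p5:
  fixes n :: nat and E :: "nat set set"
    and a :: "nat \<Rightarrow> real" and f :: "nat \<Rightarrow> real \<Rightarrow> real" and \<rho> x_star :: real
    and \<mu>_star :: "nat \<Rightarrow> real"
    and M :: "'w measure" and \<xi> :: "nat \<Rightarrow> 'w \<Rightarrow> nat set"
    and x \<mu> :: "nat \<Rightarrow> nat \<Rightarrow> 'w \<Rightarrow> real"
  assumes "n \<ge> 2" and "simple_graph n E" and "connected_graph n E" and "\<not> bipartite_graph n E"
    and "\<And>k y. k \<in> {1..n} \<Longrightarrow> f k y = (y - a k)\<^sup>2 / 2"
    and "0 < \<rho>" and "\<rho> < 1"
    and "prob_space M" and "edge_sampling n E M \<xi>"
    and "\<And>k t \<omega>. x k t \<omega> = fst (asyl_admm E f \<rho> a (\<lambda>s. \<xi> s \<omega>) t) k"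
    and "\<And>k t \<omega>. \<mu> k t \<omega> = snd (asyl_admm E f \<rho> a (\<lambda>s. \<xi> s \<omega>) t) k"
    and "x_star = (1 / real n) * (\<Sum>k=1..n. a k)"
    and "\<And>k. k \<in> {1..n} \<Longrightarrow> \<mu>_star k = (x_star - a k) / real (node_degree E k)"
  shows "\<forall>k\<in>{1..n}. AE \<omega> in M.
           (\<lambda>t. x k t \<omega> - x_star) \<longlonglongrightarrow> 0 \<and> (\<lambda>t. \<mu> k t \<omega> - \<mu>_star k) \<longlonglongrightarrow> 0"
proof
  fix k assume k: "k \<in> {1..n}"
  interpret prob_space M by fact
  interpret quadratic_admm n E a f \<rho>
    by unfold_locales (use assms in auto)
  let ?S = "\<lambda>\<omega>. asyl_admm E f \<rho> a (\<lambda>s. \<xi> s \<omega>)"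
  have indep: "indep_vars (\<lambda>_. count_space E) \<xi> UNIV"
    and pr: "\<And>t e. e \<in> E \<Longrightarrow> prob {\<omega> \<in> space M. \<xi> t \<omega> = e} = edge_prob n E e"
    using assms(9) by (auto simp: edge_sampling_def)
  have \<xi>E: "\<xi> t \<omega> \<in> E" if "\<omega> \<in> space M" for t \<omega>
    using indep that by (auto simp: indep_vars_def dest!: measurable_space)
  have "AE \<omega> in M. (\<lambda>t. V (?S \<omega> t) - V (asyl_step E f \<rho> e (?S \<omega> t))) \<longlonglongrightarrow> 0" if "e \<in> E" for e
    by (rule AE_lyapunov_decrease_tendsto_0[where init = "(a, \<lambda>k. 0)" and F = "asyl_step E f \<rho>",
          OF _ _ countable_finite[OF finite_E] indep V_nonneg V_step_le that edge_prob_pos[OF that]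
            pr[OF that]]) auto
  \<comment> \<open>Finitely many edges give one common null set; from here the argument is
    pathwise.\<close>
  then have "AE \<omega> in M. \<forall>e\<in>E. (\<lambda>t. V (?S \<omega> t) - V (asyl_step E f \<rho> e (?S \<omega> t))) \<longlonglongrightarrow> 0"
    by (intro AE_finite_allI finite_E)
  then show "AE \<omega> in M. (\<lambda>t. x k t \<omega> - x_star) \<longlonglongrightarrow> 0 \<and> (\<lambda>t. \<mu> k t \<omega> - \<mu>_star k) \<longlonglongrightarrow> 0"
  proof (rule AE_mp, intro AE_I2 impI)
    fix \<omega> assume \<omega>: "\<omega> \<in> space M"
      and dec: "\<forall>e\<in>E. (\<lambda>t. V (?S \<omega> t) - V (asyl_step E f \<rho> e (?S \<omega> t))) \<longlonglongrightarrow> 0"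
    have c: "(\<lambda>t. X (?S \<omega> t) k) \<longlonglongrightarrow> 0" "(\<lambda>t. m (?S \<omega> t) k) \<longlonglongrightarrow> 0" "deg k > 0"
      using consensus[of "?S \<omega>" k] dec sum_m_admm[of "\<lambda>s. \<xi> s \<omega>"] \<xi>E[OF \<omega>] k by blast+
    have "X (?S \<omega> t) k = x k t \<omega> - x_star" for t
      by (simp add: X_def avg_def assms(10,12))
    moreover have "m (?S \<omega> t) k / deg k = \<mu> k t \<omega> - \<mu>_star k" for t
      using c(3) by (simp add: m_def avg_def assms(11,12) assms(13)[OF k] deg_def[symmetric] field_simps)
    moreover have "(\<lambda>t. m (?S \<omega> t) k / deg k) \<longlonglongrightarrow> 0"
      using tendsto_divide[OF c(2) tendsto_const[of "deg k"]] c(3) by simp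
    ultimately show "(\<lambda>t. x k t \<omega> - x_star) \<longlonglongrightarrow> 0 \<and> (\<lambda>t. \<mu> k t \<omega> - \<mu>_star k) \<longlonglongrightarrow> 0"
      using c(1) by simp
  qed
qed

end
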